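(* Let $G$ be a $2$-connected nontrivial uniquely $C_9$-saturated graph, let $C$ be a longest even cycle among the even cycles of $G$ of length at most $12$, and let $R=V(G)\setminus V(C)$. Let $\sigma$ be an automorphism of $G$ and let $u,v$ be distinct nonadjacent vertices of $G$ fixed by $\sigma$. Then $\sigma$ fixes every vertex of $P(u,v)$. Consequently, if $w_1w_2$ is a component of $G[R]$ isomorphic to $K_2$ with $N_C(w_1)=N_C(w_2)$ and $\deg(w_i)=|N_C(w_i)|+1$ for $i=1,2$, then no $9$-path between two nonadjacent vertices outside $\{w_1,w_2\}$ passes through $w_1$ or $w_2$.
   Context: All graphs are finite and simple. A graph $G$ is uniquely $C_9$-saturated if it contains no cycle of length $9$ and, for every edge $e$ of the complement $\overline{G}$, $G+e$ contains exactly one cycle of length $9$; it is nontrivial if $|V(G)|\ge 9$. A $9$-path is a path on $9$ vertices (hence with $8$ edges). In a uniquely $C_9$-saturated graph every two distinct nonadjacent vertices $u,v$ are the endpoints of exactly one $9$-path, denoted $P(u,v)$. $G[R]$ is the subgraph induced on $R$, and $N_C(x)=N(x)\cap V(C)$. *)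

theory Defs
  imports Main
begin

record 'a ugraph =
  verts :: "'a set"
  edges :: "'a set set"

definition simple_graph :: "'a ugraph \<Rightarrow> bool" where
  "simple_graph G \<longleftrightarrow> finite (verts G) \<and> (\<forall>e \<in> edges G. e \<subseteq> verts G \<and> card e = 2)"

definition adjacent :: "'a ugraph \<Rightarrow> 'a \<Rightarrow> 'a \<Rightarrow> bool" where
  "adjacent G u v \<longleftrightarrow> {u, v} \<in> edges G"

definition neighbours :: "'a ugraph \<Rightarrow> 'a \<Rightarrow> 'a set" where
  "neighbours G v = {u \<in> verts G. adjacent G v u}"

definition degree :: "'a ugraph \<Rightarrow> 'a \<Rightarrow> nat" where
  "degree G v = card (neighbours G v)"

definition neighbours_in :: "'a ugraph \<Rightarrow> 'a ugraph \<Rightarrow> 'a \<Rightarrow> 'a set" where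
  "neighbours_in G C x = neighbours G x \<inter> verts C"

definition subgraph :: "'a ugraph \<Rightarrow> 'a ugraph \<Rightarrow> bool" where
  "subgraph H G \<longleftrightarrow> verts H \<subseteq> verts G \<and> edges H \<subseteq> edges G \<and>
     (\<forall>e \<in> edges H. e \<subseteq> verts H)"

definition induced_subgraph :: "'a ugraph \<Rightarrow> 'a set \<Rightarrow> 'a ugraph" where
  "induced_subgraph G S = \<lparr>verts = verts G \<inter> S, edges = {e \<in> edges G. e \<subseteq> S}\<rparr>"

definition complement :: "'a ugraph \<Rightarrow> 'a ugraph" where
  "complement G = \<lparr>verts = verts G, edges = {e. e \<subseteq> verts G \<and> card e = 2 \<and> e \<notin> edges G}\<rparr>"

definition add_edge :: "'a ugraph \<Rightarrow> 'a set \<Rightarrow> 'a ugraph" where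
  "add_edge G e = \<lparr>verts = verts G, edges = insert e (edges G)\<rparr>"

text \<open>Paths and cycles are graphs, not vertex sequences, so that counting them means counting
  subgraphs: a sequence and its reversal (or rotation, for cycles) give the same object.\<close>

definition path_graph :: "'a list \<Rightarrow> 'a ugraph" where
  "path_graph vs = \<lparr>verts = set vs, edges = {{vs ! i, vs ! Suc i} | i. Suc i < length vs}\<rparr>"

definition cycle_graph :: "'a list \<Rightarrow> 'a ugraph" where
  "cycle_graph vs = \<lparr>verts = set vs,
     edges = {{vs ! i, vs ! (Suc i mod length vs)} | i. i < length vs}\<rparr>"

text \<open>The parameter \<open>n\<close> counts the vertices of the path.\<close>

definition path_between :: "'a ugraph \<Rightarrow> nat \<Rightarrow> 'a \<Rightarrow> 'a \<Rightarrow> 'a ugraph \<Rightarrow> bool" where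
  "path_between G n u v P \<longleftrightarrow> subgraph P G \<and>
     (\<exists>vs. vs \<noteq> [] \<and> distinct vs \<and> length vs = n \<and> hd vs = u \<and> last vs = v \<and> P = path_graph vs)"

definition cycle_in :: "'a ugraph \<Rightarrow> nat \<Rightarrow> 'a ugraph \<Rightarrow> bool" where
  "cycle_in G n C \<longleftrightarrow> subgraph C G \<and>
     (\<exists>vs. distinct vs \<and> length vs = n \<and> n \<ge> 3 \<and> C = cycle_graph vs)"

definition connected_graph :: "'a ugraph \<Rightarrow> bool" where
  "connected_graph G \<longleftrightarrow> verts G \<noteq> {} \<and>
     (\<forall>u \<in> verts G. \<forall>v \<in> verts G. \<exists>n P. path_between G n u v P)"

definition k_connected :: "nat \<Rightarrow> 'a ugraph \<Rightarrow> bool" where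
  "k_connected k G \<longleftrightarrow> card (verts G) > k \<and>
     (\<forall>X \<subseteq> verts G. card X < k \<longrightarrow> connected_graph (induced_subgraph G (verts G - X)))"

definition component :: "'a ugraph \<Rightarrow> 'a ugraph \<Rightarrow> bool" where
  "component H G \<longleftrightarrow> subgraph H G \<and> connected_graph H \<and>
     (\<forall>H'. subgraph H' G \<and> connected_graph H' \<and> subgraph H H' \<longrightarrow> H' = H)"

definition automorphism :: "'a ugraph \<Rightarrow> ('a \<Rightarrow> 'a) \<Rightarrow> bool" where
  "automorphism G \<sigma> \<longleftrightarrow> bij_betw \<sigma> (verts G) (verts G) \<and>
     (\<forall>u \<in> verts G. \<forall>v \<in> verts G. adjacent G u v \<longleftrightarrow> adjacent G (\<sigma> u) (\<sigma> v))"

definition uniquely_cycle_saturated :: "nat \<Rightarrow> 'a ugraph \<Rightarrow> bool" where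
  "uniquely_cycle_saturated k G \<longleftrightarrow> (\<nexists>C. cycle_in G k C) \<and>
     (\<forall>e \<in> edges (complement G). \<exists>!C. cycle_in (add_edge G e) k C)"

text \<open>Well defined for distinct nonadjacent vertices of a uniquely \<open>C\<^sub>9\<close>-saturated graph.\<close>

definition nine_path :: "'a ugraph \<Rightarrow> 'a \<Rightarrow> 'a \<Rightarrow> 'a ugraph" where
  "nine_path G u v = (THE P. path_between G 9 u v P)"

definition longest_even_cycle_upto :: "'a ugraph \<Rightarrow> nat \<Rightarrow> 'a ugraph \<Rightarrow> bool" where
  "longest_even_cycle_upto G m C \<longleftrightarrow>
     (\<exists>n. cycle_in G n C \<and> even n \<and> n \<le> m \<and>
       (\<forall>n' C'. cycle_in G n' C' \<and> even n' \<and> n' \<le> m \<longrightarrow> n' \<le> n))"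

end

theory Submission
  imports Defs "HOL-Combinatorics.Transposition"
begin

text \<open>Everything rests on the uniqueness of \<open>9\<close>-paths. If \<open>G\<close> has no \<open>k\<close>-cycle, a \<open>k\<close>-path
  between distinct nonadjacent vertices \<open>u\<close> and \<open>v\<close> is the same thing as a \<open>k\<close>-cycle of \<open>G + uv\<close>
  with the edge \<open>uv\<close> removed, because every \<open>k\<close>-cycle of \<open>G + uv\<close> must use \<open>uv\<close>. So in a
  uniquely \<open>C\<^sub>k\<close>-saturated graph, \<open>u\<close> and \<open>v\<close> are joined by exactly one \<open>k\<close>-path (lemma \<open>saturated_unique_path\<close>).

  An automorphism fixing \<open>u\<close> and \<open>v\<close> maps this path to a \<open>k\<close>-path between \<open>u\<close> and \<open>v\<close>, hence to
  itself. A path has no nontrivial symmetry fixing one of its ends (lemma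
  \<open>path_graph_determines_list\<close>), so every vertex of the path is fixed
  (lemma \<open>automorphism_fixes_path\<close>).

  For the consequence, the component and the conditions on degrees and neighbourhoods show
  that \<open>w1\<close> and \<open>w2\<close> are adjacent twins, so exchanging them is an automorphism. It fixes all other vertices, in particular
  the ends of the path, but neither \<open>w1\<close> nor \<open>w2\<close>; so these do not lie on the path.\<close>

section \<open>Paths and cycles as vertex lists\<close>

lemma verts_path_graph [simp]: "verts (path_graph vs) = set vs"
  by (simp add: path_graph_def)

lemma path_graph_edgeI: "Suc i < length vs \<Longrightarrow> {vs ! i, vs ! Suc i} \<in> edges (path_graph vs)"
  by (auto simp: path_graph_def)

lemma subgraph_path_graph_iff:
  "subgraph (path_graph vs) G \<longleftrightarrow>
     set vs \<subseteq> verts G \<and> (\<forall>i. Suc i < length vs \<longrightarrow> {vs ! i, vs ! Suc i} \<in> edges G)"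
  by (auto simp: subgraph_def path_graph_def)

lemma subgraph_cycle_graph_iff:
  "subgraph (cycle_graph vs) G \<longleftrightarrow>
     set vs \<subseteq> verts G \<and> (\<forall>i < length vs. {vs ! i, vs ! (Suc i mod length vs)} \<in> edges G)"
proof -
  have "vs ! (Suc i mod length vs) \<in> set vs" if "i < length vs" for i
    using that by (intro nth_mem mod_less_divisor) auto
  then show ?thesis
    by (auto simp: subgraph_def cycle_graph_def)
qed

lemma subgraph_path_graph_rev:
  assumes "subgraph (path_graph vs) G"
  shows "subgraph (path_graph (rev vs)) G"
  unfolding subgraph_path_graph_iff
proof (intro conjI allI impI)
  show "set (rev vs) \<subseteq> verts G"
    using assms by (simp add: subgraph_path_graph_iff)
next
  fix i assume i: "Suc i < length (rev vs)"
  define j where "j = length vs - Suc (Suc i)"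
  have "rev vs ! i = vs ! Suc j" "rev vs ! Suc i = vs ! j" "Suc j < length vs"
    using i by (auto simp: rev_nth j_def Suc_diff_Suc)
  then show "{rev vs ! i, rev vs ! Suc i} \<in> edges G"
    using assms by (metis insert_commute subgraph_path_graph_iff)
qed

text \<open>The last index is the only one that the reduction modulo the length affects, so closing a
  path up adds just the edge between its ends.\<close>

lemma edges_cycle_graph:
  assumes "vs \<noteq> []"
  shows "edges (cycle_graph vs) = insert {hd vs, last vs} (edges (path_graph vs))"
proof -
  define f where "f i = {vs ! i, vs ! (Suc i mod length vs)}" for i
  have indices: "{..<length vs} = insert (length vs - 1) {i. Suc i < length vs}"
    using assms by (cases vs) auto
  have "edges (cycle_graph vs) = f ` {..<length vs}"
    by (auto simp: cycle_graph_def f_def)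
  also have "\<dots> = insert (f (length vs - 1)) (f ` {i. Suc i < length vs})"
    by (simp only: indices image_insert)
  also have "f ` {i. Suc i < length vs} = (\<lambda>i. {vs ! i, vs ! Suc i}) ` {i. Suc i < length vs}"
    by (intro image_cong) (simp_all add: f_def)
  also have "\<dots> = edges (path_graph vs)"
    by (auto simp: path_graph_def)
  also have "f (length vs - 1) = {hd vs, last vs}"
    using assms by (auto simp: f_def hd_conv_nth last_conv_nth)
  finally show ?thesis
    by simp
qed

text \<open>Walking along both lists from the common first vertex, the next vertex is forced: a vertex of
  a path has at most two neighbours on the path, and one of them is the vertex just left.\<close>

lemma path_graph_determines_list:
  assumes "distinct vs" "distinct ws" "path_graph vs = path_graph ws" "hd vs = hd ws"
  shows "vs = ws"
proof (rule nth_equalityI)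
  have "set vs = set ws"
    using assms(3) by (metis verts_path_graph)
  then show len: "length vs = length ws"
    using assms(1,2) by (metis distinct_card)
  fix i assume "i < length vs"
  then show "vs ! i = ws ! i"
  proof (induction i rule: less_induct)
    case (less i)
    show ?case
    proof (cases i)
      case 0
      then show ?thesis
        using less.prems len assms(4) by (metis hd_conv_nth length_greater_0_conv)
    next
      case (Suc k)
      then have k: "vs ! k = ws ! k"
        using less by simp
      have "{ws ! k, ws ! Suc k} \<in> edges (path_graph vs)"
        using assms(3) path_graph_edgeI[of k ws] less.prems len Suc by simp
      then obtain j where j: "Suc j < length vs" "{ws ! k, ws ! Suc k} = {vs ! j, vs ! Suc j}"
        by (auto simp: path_graph_def)
      then consider "vs ! k = vs ! j" "ws ! Suc k = vs ! Suc j"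
        | "vs ! k = vs ! Suc j" "ws ! Suc k = vs ! j"
        using k by (auto simp: doubleton_eq_iff)
      then show ?thesis
      proof cases
        case 1
        then have "k = j"
          using assms(1) j less.prems Suc by (simp add: nth_eq_iff_index_eq)
        then show ?thesis
          using 1 Suc by simp
      next
        \<comment> \<open>Here the second list would step back to a vertex that it has already visited.\<close>
        case 2
        then have "k = Suc j"
          using assms(1) j less.prems Suc by (simp add: nth_eq_iff_index_eq)
        then have "ws ! Suc k = ws ! j"
          using 2 less.IH[of j] j Suc by simp
        then show ?thesis
          using assms(2) \<open>k = Suc j\<close> less.prems len Suc by (simp add: nth_eq_iff_index_eq)
      qed
    qed
  qed
qed

text \<open>This is where three vertices are needed: the ends of a path on two vertices do form one of its
  edges.\<close>

lemma path_edge_not_ends: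
  assumes "distinct vs" "length vs \<ge> 3"
  shows "{hd vs, last vs} \<notin> edges (path_graph vs)"
proof
  assume "{hd vs, last vs} \<in> edges (path_graph vs)"
  then obtain i where i: "Suc i < length vs" "{hd vs, last vs} = {vs ! i, vs ! Suc i}"
    by (auto simp: path_graph_def)
  have "vs \<noteq> []"
    using assms(2) by auto
  then have "hd vs = vs ! 0" "last vs = vs ! (length vs - 1)"
    by (simp_all add: hd_conv_nth last_conv_nth)
  with \<open>vs \<noteq> []\<close> have "(0 = i \<and> length vs - 1 = Suc i) \<or> (0 = Suc i \<and> length vs - 1 = i)"
    using i assms(1) by (auto simp: doubleton_eq_iff nth_eq_iff_index_eq)
  then show False
    using assms(2) by auto
qed

lemma cycle_graph_rotate_subgraph:
  assumes "subgraph (cycle_graph vs) G"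
  shows "subgraph (cycle_graph (rotate m vs)) G"
  unfolding subgraph_cycle_graph_iff
proof (intro conjI allI impI)
  show "set (rotate m vs) \<subseteq> verts G"
    using assms by (simp add: subgraph_cycle_graph_iff)
next
  fix i assume i: "i < length (rotate m vs)"
  define n where "n = length vs"
  have "n > 0" "i < n"
    using i by (auto simp: n_def)
  have "rotate m vs ! i = vs ! ((m + i) mod n)"
    using \<open>i < n\<close> by (simp add: nth_rotate n_def)
  moreover have "rotate m vs ! (Suc i mod n) = vs ! ((m + Suc i mod n) mod n)"
    unfolding n_def using \<open>n > 0\<close> by (intro nth_rotate) (simp add: n_def)
  moreover have "(m + Suc i mod n) mod n = Suc ((m + i) mod n) mod n"
    by (simp add: mod_Suc_eq mod_add_right_eq)
  ultimately show "{rotate m vs ! i, rotate m vs ! (Suc i mod length (rotate m vs))} \<in> edges G"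
    using assms \<open>n > 0\<close> by (simp add: subgraph_cycle_graph_iff n_def)
qed

section \<open>Uniqueness of paths in saturated graphs\<close>

lemma cycle_of_path:
  assumes "distinct vs" "length vs \<ge> 3" "subgraph (path_graph vs) G"
  shows "cycle_in (add_edge G {hd vs, last vs}) (length vs) (cycle_graph vs)"
proof -
  have "vs \<noteq> []"
    using assms(2) by auto
  have "verts (cycle_graph vs) = set vs"
    by (simp add: cycle_graph_def)
  moreover have "hd vs \<in> set vs" "last vs \<in> set vs"
    using \<open>vs \<noteq> []\<close> by auto
  ultimately have "subgraph (cycle_graph vs) (add_edge G {hd vs, last vs})"
    using assms(3) \<open>vs \<noteq> []\<close>
    by (auto simp: subgraph_def edges_cycle_graph add_edge_def path_graph_def)
  then show ?thesis
    using assms by (auto simp: cycle_in_def)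
qed

lemma path_between_sym:
  assumes "path_between G n u v P"
  shows "\<exists>Q. path_between G n v u Q"
proof -
  obtain vs where "vs \<noteq> []" "distinct vs" "length vs = n" "hd vs = u" "last vs = v"
      "subgraph (path_graph vs) G"
    using assms by (auto simp: path_between_def)
  then have "path_between G n v u (path_graph (rev vs))"
    unfolding path_between_def
    by (intro conjI exI[of _ "rev vs"]) (auto simp: hd_rev last_rev subgraph_path_graph_rev)
  then show ?thesis ..
qed

text \<open>A \<open>k\<close>-cycle that appears when \<open>uv\<close> is added runs through \<open>uv\<close>; rotating its vertex list until
  \<open>uv\<close> is the closing edge exhibits the rest of the cycle as a path of \<open>G\<close>. The orientation of \<open>uv\<close> on
  the cycle is not under control, hence the use of symmetry at the end.\<close>

lemma path_of_cycle:
  assumes "cycle_in (add_edge G {u, v}) k D" "\<nexists>D. cycle_in G k D"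
  shows "\<exists>P. path_between G k u v P"
proof -
  obtain vs where vs: "distinct vs" "length vs = k" "k \<ge> 3" "D = cycle_graph vs"
      "subgraph (cycle_graph vs) (add_edge G {u, v})"
    using assms(1) by (auto simp: cycle_in_def)
  have "\<not> subgraph (cycle_graph vs) G"
    using assms(2) vs by (auto simp: cycle_in_def)
  then obtain i where i: "i < k" "{vs ! i, vs ! (Suc i mod k)} = {u, v}"
    using vs(2,5) by (auto simp: subgraph_cycle_graph_iff add_edge_def)
  define ws where "ws = rotate (Suc i) vs"
  have ws: "distinct ws" "length ws = k" "ws \<noteq> []"
    using vs by (auto simp: ws_def)
  have "ws ! 0 = vs ! (Suc i mod k)"
    using vs(2,3) nth_rotate[of 0 vs "Suc i"] by (simp add: ws_def)
  moreover have "ws ! (k - 1) = vs ! i"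
    using vs(2,3) i(1) nth_rotate[of "k - 1" vs "Suc i"] by (simp add: ws_def)
  ultimately have ends: "{hd ws, last ws} = {u, v}"
    using i(2) ws by (simp add: hd_conv_nth last_conv_nth insert_commute)
  have sub: "subgraph (cycle_graph ws) (add_edge G {u, v})"
    unfolding ws_def by (rule cycle_graph_rotate_subgraph[OF vs(5)])
  have "{u, v} \<notin> edges (path_graph ws)"
    using path_edge_not_ends[of ws] ws vs(3) ends by simp
  moreover have "edges (path_graph ws) \<subseteq> insert {u, v} (edges G)"
    using sub ws(3) by (auto simp: subgraph_def edges_cycle_graph add_edge_def)
  moreover have "set ws \<subseteq> verts G"
    using sub by (simp add: subgraph_cycle_graph_iff add_edge_def)
  ultimately have "subgraph (path_graph ws) G"
    unfolding subgraph_path_graph_iff using path_graph_edgeI[of _ ws] by fastforce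
  then have "path_between G k (hd ws) (last ws) (path_graph ws)"
    using ws by (auto simp: path_between_def)
  moreover have "(hd ws = u \<and> last ws = v) \<or> (hd ws = v \<and> last ws = u)"
    using ends by (auto simp: doubleton_eq_iff)
  ultimately show ?thesis
    using path_between_sym by metis
qed

lemma saturated_unique_path:
  assumes "uniquely_cycle_saturated k G" "k \<ge> 3"
    and "u \<in> verts G" "v \<in> verts G" "u \<noteq> v" "\<not> adjacent G u v"
  shows "\<exists>!P. path_between G k u v P"
proof -
  have "{u, v} \<in> edges (complement G)"
    using assms by (auto simp: complement_def adjacent_def)
  then have unique: "\<exists>!D. cycle_in (add_edge G {u, v}) k D"
    using assms(1) by (simp add: uniquely_cycle_saturated_def)
  show ?thesis
  proof (rule ex_ex1I)
    show "\<exists>P. path_between G k u v P"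
      using unique path_of_cycle assms(1) by (metis uniquely_cycle_saturated_def)
  next
    \<comment> \<open>As \<open>uv\<close> is not an edge of \<open>G\<close>, removing it from the closed-up cycle recovers the path, so
      different paths would close up to different cycles.\<close>
    have cycle: "cycle_in (add_edge G {u, v}) k \<lparr>verts = verts P, edges = insert {u, v} (edges P)\<rparr>
        \<and> {u, v} \<notin> edges P" if "path_between G k u v P" for P
    proof -
      from that obtain vs where vs: "vs \<noteq> []" "distinct vs" "length vs = k" "hd vs = u"
          "last vs = v" "P = path_graph vs" "subgraph P G"
        by (auto simp: path_between_def)
      have "cycle_graph vs = \<lparr>verts = verts P, edges = insert {u, v} (edges P)\<rparr>"
        using edges_cycle_graph[of vs] vs
        by (intro ugraph.equality) (auto simp: cycle_graph_def path_graph_def)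
      then show ?thesis
        using cycle_of_path[of vs G] vs assms(2,6) by (auto simp: subgraph_def adjacent_def)
    qed
    fix P Q assume "path_between G k u v P" "path_between G k u v Q"
    then have "verts P = verts Q" "insert {u, v} (edges P) = insert {u, v} (edges Q)"
        "{u, v} \<notin> edges P" "{u, v} \<notin> edges Q"
      using cycle[of P] cycle[of Q] unique by (auto dest: ex1_implies_ex)
    then show "P = Q"
      by (intro ugraph.equality) (auto simp: insert_ident)
  qed
qed

section \<open>Automorphisms\<close>

lemma automorphism_map_path:
  assumes "automorphism G \<sigma>" "subgraph (path_graph vs) G"
  shows "subgraph (path_graph (map \<sigma> vs)) G"
  unfolding subgraph_path_graph_iff
proof (intro conjI allI impI)
  have vs: "set vs \<subseteq> verts G"
    using assms(2) by (simp add: subgraph_path_graph_iff)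
  show "set (map \<sigma> vs) \<subseteq> verts G"
    using assms(1) vs by (auto simp: automorphism_def bij_betw_def)
  fix i assume i: "Suc i < length (map \<sigma> vs)"
  then have "adjacent G (vs ! i) (vs ! Suc i)"
    using assms(2) by (simp add: subgraph_path_graph_iff adjacent_def)
  moreover have "vs ! i \<in> verts G" "vs ! Suc i \<in> verts G"
    using i vs by (auto dest: nth_mem)
  ultimately have "adjacent G (\<sigma> (vs ! i)) (\<sigma> (vs ! Suc i))"
    using assms(1) by (simp add: automorphism_def)
  then show "{map \<sigma> vs ! i, map \<sigma> vs ! Suc i} \<in> edges G"
    using i by (simp add: adjacent_def)
qed

text \<open>The image of the path is again a \<open>k\<close>-path between \<open>u\<close> and \<open>v\<close>, hence the same graph. The two
  vertex lists also start at the same end, so they agree entry by entry.\<close>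

lemma automorphism_fixes_path:
  assumes "uniquely_cycle_saturated k G" "k \<ge> 3"
    and "u \<in> verts G" "v \<in> verts G" "u \<noteq> v" "\<not> adjacent G u v"
    and "automorphism G \<sigma>" "\<sigma> u = u" "\<sigma> v = v"
    and "path_between G k u v P" "x \<in> verts P"
  shows "\<sigma> x = x"
proof -
  obtain vs where vs: "vs \<noteq> []" "distinct vs" "length vs = k" "hd vs = u" "last vs = v"
      "P = path_graph vs" "subgraph (path_graph vs) G"
    using assms(10) by (auto simp: path_between_def)
  have "inj_on \<sigma> (set vs)"
    using assms(7) vs(7)
    by (auto simp: automorphism_def bij_betw_def subgraph_path_graph_iff intro: inj_on_subset)
  then have distinct: "distinct (map \<sigma> vs)"
    using vs(2) by (simp add: distinct_map)
  have ends: "hd (map \<sigma> vs) = u" "last (map \<sigma> vs) = v"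
    using vs assms(8,9) by (simp_all add: hd_map last_map)
  have "path_between G k u v (path_graph (map \<sigma> vs))"
    unfolding path_between_def
    using automorphism_map_path[OF assms(7) vs(7)] distinct ends vs(1,3)
    by (intro conjI exI[of _ "map \<sigma> vs"]) auto
  then have "path_graph (map \<sigma> vs) = path_graph vs"
    using saturated_unique_path[OF assms(1-6)] assms(10) vs(6) by blast
  then have "map \<sigma> vs = vs"
    using path_graph_determines_list distinct vs(2,4) ends(1) by metis
  then show ?thesis
    using assms(11) vs(6) by (metis map_eq_conv list.map_ident verts_path_graph)
qed

section \<open>Adjacent twins\<close>

lemma adjacent_commute: "adjacent G u v \<longleftrightarrow> adjacent G v u"
  by (simp add: adjacent_def insert_commute)

lemma transpose_twins_automorphism:
  assumes "simple_graph G" "w1 \<in> verts G" "w2 \<in> verts G"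
    and twins: "neighbours G w1 - {w2} = neighbours G w2 - {w1}"
  shows "automorphism G (transpose w1 w2)"
proof -
  have irrefl: "\<not> adjacent G x x" for x
    using assms(1) by (auto simp: simple_graph_def adjacent_def)
  have twin: "adjacent G w1 x \<longleftrightarrow> adjacent G w2 x" if "x \<in> verts G" "x \<noteq> w1" "x \<noteq> w2" for x
    using twins that by (auto simp: neighbours_def)
  have twin': "adjacent G x w1 \<longleftrightarrow> adjacent G x w2" if "x \<in> verts G" "x \<noteq> w1" "x \<noteq> w2" for x
    using twin[OF that] adjacent_commute by metis
  have "adjacent G x y \<longleftrightarrow> adjacent G (transpose w1 w2 x) (transpose w1 w2 y)"
    if "x \<in> verts G" "y \<in> verts G" for x y
  proof -
    consider "x = w1" | "x = w2" | "x \<noteq> w1" "x \<noteq> w2"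
      by blast
    then show ?thesis
    proof cases
      case 1
      then show ?thesis
        using that irrefl adjacent_commute[of G w1 w2] twin[of y]
        by (cases "y = w1"; cases "y = w2") simp_all
    next
      case 2
      then show ?thesis
        using that irrefl adjacent_commute[of G w1 w2] twin[of y]
        by (cases "y = w1"; cases "y = w2") simp_all
    next
      case 3
      then show ?thesis
        using that twin'[of x] by (cases "y = w1"; cases "y = w2") simp_all
    qed
  qed
  moreover have "transpose w1 w2 ` verts G = verts G"
    using assms(2,3) by (intro transpose_image_eq) simp
  ultimately show ?thesis
    by (simp add: automorphism_def bij_betw_def)
qed

text \<open>The degree condition leaves room for exactly one neighbour off \<open>C\<close>, and \<open>w'\<close> is one.\<close>

lemma neighbours_eq_if_degree:
  assumes "simple_graph G" "w' \<in> neighbours G w" "w' \<notin> verts C"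
    and "degree G w = card (neighbours_in G C w) + 1"
  shows "neighbours G w = insert w' (neighbours_in G C w)"
proof -
  have finite: "finite (neighbours G w)"
    using assms(1) by (simp add: simple_graph_def neighbours_def)
  have "insert w' (neighbours_in G C w) \<subseteq> neighbours G w"
    using assms(2) by (auto simp: neighbours_in_def)
  moreover have "card (insert w' (neighbours_in G C w)) = card (neighbours G w)"
    using assms(3,4) finite by (simp add: neighbours_in_def degree_def)
  ultimately show ?thesis
    using finite card_subset_eq by metis
qed

theorem lemma2p2:
  fixes G C :: "'a ugraph" and R :: "'a set"
  assumes "simple_graph G"
    and "k_connected 2 G"
    and "card (verts G) \<ge> 9"
    and "uniquely_cycle_saturated 9 G"
    and "longest_even_cycle_upto G 12 C"
    and "R = verts G - verts C"
  shows "(\<forall>\<sigma> u v. automorphism G \<sigma> \<and> u \<in> verts G \<and> v \<in> verts G \<and> u \<noteq> v \<and> \<not> adjacent G u v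
             \<and> \<sigma> u = u \<and> \<sigma> v = v
           \<longrightarrow> (\<forall>x \<in> verts (nine_path G u v). \<sigma> x = x))
       \<and> (\<forall>w1 w2. w1 \<noteq> w2
             \<and> component \<lparr>verts = {w1, w2}, edges = {{w1, w2}}\<rparr> (induced_subgraph G R)
             \<and> neighbours_in G C w1 = neighbours_in G C w2
             \<and> degree G w1 = card (neighbours_in G C w1) + 1
             \<and> degree G w2 = card (neighbours_in G C w2) + 1
           \<longrightarrow> (\<forall>x y P. x \<in> verts G - {w1, w2} \<and> y \<in> verts G - {w1, w2}
                   \<and> x \<noteq> y \<and> \<not> adjacent G x y \<and> path_between G 9 x y P
                 \<longrightarrow> w1 \<notin> verts P \<and> w2 \<notin> verts P))"
proof (intro conjI allI impI ballI)
  fix \<sigma> u v x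
  assume *: "automorphism G \<sigma> \<and> u \<in> verts G \<and> v \<in> verts G \<and> u \<noteq> v \<and> \<not> adjacent G u v
      \<and> \<sigma> u = u \<and> \<sigma> v = v" and x: "x \<in> verts (nine_path G u v)"
  have "\<exists>!P. path_between G 9 u v P"
    using saturated_unique_path[of 9 G u v] assms(4) * by simp
  then have "path_between G 9 u v (nine_path G u v)"
    unfolding nine_path_def by (rule theI')
  then show "\<sigma> x = x"
    using automorphism_fixes_path[of 9 G u v \<sigma>] assms(4) * x by simp
next
  fix w1 w2 x y P
  assume w: "w1 \<noteq> w2
      \<and> component \<lparr>verts = {w1, w2}, edges = {{w1, w2}}\<rparr> (induced_subgraph G R)
      \<and> neighbours_in G C w1 = neighbours_in G C w2
      \<and> degree G w1 = card (neighbours_in G C w1) + 1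
      \<and> degree G w2 = card (neighbours_in G C w2) + 1"
    and xy: "x \<in> verts G - {w1, w2} \<and> y \<in> verts G - {w1, w2}
      \<and> x \<noteq> y \<and> \<not> adjacent G x y \<and> path_between G 9 x y P"
  have "subgraph \<lparr>verts = {w1, w2}, edges = {{w1, w2}}\<rparr> (induced_subgraph G R)"
    using w unfolding component_def by blast
  then have in_R: "w1 \<in> verts G" "w2 \<in> verts G" "w1 \<notin> verts C" "w2 \<notin> verts C" "adjacent G w1 w2"
    using assms(6) by (auto simp: subgraph_def induced_subgraph_def adjacent_def)
  then have "w2 \<in> neighbours G w1" "w1 \<in> neighbours G w2"
    using adjacent_commute[of G w1 w2] by (simp_all add: neighbours_def)
  then have "neighbours G w1 = insert w2 (neighbours_in G C w1)"
      "neighbours G w2 = insert w1 (neighbours_in G C w2)"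
    using neighbours_eq_if_degree[of G w2 w1 C] neighbours_eq_if_degree[of G w1 w2 C]
      assms(1) in_R w by simp_all
  moreover have "w1 \<notin> neighbours_in G C w2" "w2 \<notin> neighbours_in G C w1"
    using in_R by (auto simp: neighbours_in_def)
  ultimately have "neighbours G w1 - {w2} = neighbours G w2 - {w1}"
    using w by simp
  then have "automorphism G (transpose w1 w2)"
    using transpose_twins_automorphism[of G w1 w2] assms(1) in_R by simp
  then have fixed: "transpose w1 w2 z = z" if "z \<in> verts P" for z
    using automorphism_fixes_path[of 9 G x y "transpose w1 w2" P z] assms(4) xy that
    by simp
  show "w1 \<notin> verts P"
    using fixed[of w1] w by auto
  show "w2 \<notin> verts P"
    using fixed[of w2] w by auto
qed

end
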